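(* Let $G$ and $A$ be profinite groups, and let $f \colon G \to A$ be a continuous polynomial map. Then either $f(G)$ is finite or $|f(G)| \ge 2^{\aleph_0}$.
   Context: Polynomial maps (in the sense of Passi): let $G$ and $A$ be groups and $f\colon G\to A$ a map. For $h\in G$ define the difference operator by $\Delta_h f(x)=f(x)^{-1}f(xh)$ for $x \in G$. The map $f$ is polynomial of degree at most $n$ if $\Delta_{h_{n+1}}\cdots\Delta_{h_1}f(x)=1$ for all $x,h_1,\dots,h_{n+1}\in G$. The map $f$ is polynomial if it is polynomial of degree at most $n$ for some integer $n\ge 0$. The group $A$ is not assumed to be abelian. *)

theory Defs
  imports "HOL-Analysis.Analysis" "HOL-Algebra.Group"
begin

definition totally_disconnected_space :: "'a topology \<Rightarrow> bool" where
  "totally_disconnected_space T \<longleftrightarrow> (\<forall>S. connectedin T S \<longrightarrow> (\<exists>a. S \<subseteq> {a}))"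

locale topological_group = group G for G (structure) and T :: "'a topology" +
  assumes topspace_eq_carrier: "topspace T = carrier G"
    and continuous_mult: "continuous_map (prod_topology T T) T (\<lambda>(x, y). x \<otimes> y)"
    and continuous_inv: "continuous_map T T (\<lambda>x. inv x)"

locale profinite_group = topological_group +
  assumes compact: "compact_space T"
    and Hausdorff: "Hausdorff_space T"
    and totally_disconnected: "totally_disconnected_space T"

definition difference_op ::
  "('a, 'm) monoid_scheme \<Rightarrow> ('b, 'n) monoid_scheme \<Rightarrow> 'a \<Rightarrow> ('a \<Rightarrow> 'b) \<Rightarrow> 'a \<Rightarrow> 'b" where
  "difference_op G A h f = (\<lambda>x. inv\<^bsub>A\<^esub> (f x) \<otimes>\<^bsub>A\<^esub> f (x \<otimes>\<^bsub>G\<^esub> h))"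

text \<open>For \<open>hs = [h\<^sub>1, \<dots>, h\<^sub>k]\<close>, the function \<open>fold (difference_op G A) hs f\<close>
  is \<open>\<Delta>\<^bsub>h\<^sub>k\<^esub> \<dots> \<Delta>\<^bsub>h\<^sub>1\<^esub> f\<close>: the operator for \<open>h\<^sub>1\<close> is applied first.\<close>

definition polynomial_map_deg_le ::
  "('a, 'm) monoid_scheme \<Rightarrow> ('b, 'n) monoid_scheme \<Rightarrow> nat \<Rightarrow> ('a \<Rightarrow> 'b) \<Rightarrow> bool" where
  "polynomial_map_deg_le G A n f \<longleftrightarrow>
     f \<in> carrier G \<rightarrow> carrier A \<and>
     (\<forall>x \<in> carrier G. \<forall>hs. length hs = n + 1 \<and> set hs \<subseteq> carrier G \<longrightarrow>
        fold (difference_op G A) hs f x = \<one>\<^bsub>A\<^esub>)"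

definition polynomial_map ::
  "('a, 'm) monoid_scheme \<Rightarrow> ('b, 'n) monoid_scheme \<Rightarrow> ('a \<Rightarrow> 'b) \<Rightarrow> bool" where
  "polynomial_map G A f \<longleftrightarrow> (\<exists>n. polynomial_map_deg_le G A n f)"

end

theory Submission
  imports Defs
begin

text \<open>
  The proof is by induction on the degree, for a compact group \<open>G\<close> and a Hausdorff group \<open>A\<close>.
  Suppose that \<open>f(G)\<close> has fewer than \<open>2\<^sup>\<aleph>\<^sup>0\<close> points. Each \<open>\<Delta>\<^sub>h f\<close> is again continuous
  and polynomial, of smaller degree, and its image lies in \<open>f(G)\<^sup>-\<^sup>1 f(G)\<close>, which also has fewer
  than \<open>2\<^sup>\<aleph>\<^sup>0\<close> points because an infinite set is equipotent with its square. By induction every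
  \<open>\<Delta>\<^sub>h f\<close> has finite image.

  A nonempty compact Hausdorff space without isolated points has at least \<open>2\<^sup>\<aleph>\<^sup>0\<close> points
  (\<open>lepoll_perfect_set\<close>), so \<open>f(G)\<close> has an isolated point \<open>a\<close>, and \<open>f\<close> is constant with value
  \<open>a\<close> on the nonempty open set \<open>V = f\<^sup>-\<^sup>1(a)\<close>. Since \<open>f(vh) = a \<Delta>\<^sub>h f(v)\<close> for \<open>v \<in> V\<close>, the map
  \<open>f\<close> takes finitely many values on each translate \<open>Vh\<close>, and finitely many of these translates
  cover \<open>G\<close> (\<open>finite_image_if_finite_differences\<close>).
\<close>

section \<open>Cardinalities of squares and of compact spaces\<close>

lemma infinite_lepoll_square_imp_lepoll:
  assumes "infinite B" and "B \<lesssim> Y \<times> Y"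
  shows "B \<lesssim> Y"
proof -
  have "infinite Y"
    using assms unfolding infinite_le_lepoll
    by (metis finite_SigmaI infinite_le_lepoll lepoll_trans)
  then have "Y \<times> Y \<approx> Y"
    by (simp add: eqpoll_iff_card_of_ordIso card_of_Times_same_infinite)
  then show ?thesis
    using assms(2) lepoll_trans2 by blast
qed

lemma compact_Hausdorff_isolated_point:
  assumes "compact_space X" and "Hausdorff_space X" and "topspace X \<noteq> {}"
    and small: "\<not> (UNIV :: nat set set) \<lesssim> topspace X"
  obtains a where "a \<in> topspace X" and "openin X {a}"
proof -
  have "\<not> (UNIV :: real set) \<lesssim> topspace X"
    using small lepoll_trans1[OF nat_sets_eqpoll_reals] by metis
  then have "X derived_set_of topspace X \<noteq> topspace X"
    using lepoll_perfect_set[of X "topspace X"] assms(1-3) compact_imp_locally_compact_space[of X]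
    by metis
  then obtain a where a: "a \<in> topspace X" "a \<notin> X derived_set_of topspace X"
    using derived_set_of_subset_topspace[of X "topspace X"] by blast
  then obtain T where T: "a \<in> T" "openin X T" "\<forall>y\<in>topspace X. y \<in> T \<longrightarrow> y = a"
    unfolding in_derived_set_of by metis
  then have "T = {a}"
    using openin_subset[OF T(2)] by blast
  then show thesis
    using that a(1) T(2) by simp
qed

section \<open>Difference operators on topological groups\<close>

lemma (in topological_group) continuous_map_mult:
  assumes "continuous_map X T p" and "continuous_map X T q"
  shows "continuous_map X T (\<lambda>x. p x \<otimes> q x)"
proof -
  have "continuous_map X (prod_topology T T) (\<lambda>x. (p x, q x))"
    using assms by (simp add: continuous_map_pairwise o_def)
  from continuous_map_compose[OF this continuous_mult] show ?thesis
    by (simp add: o_def)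
qed

lemma (in topological_group) continuous_map_right_translation:
  assumes "h \<in> carrier G"
  shows "continuous_map T T (\<lambda>x. x \<otimes> h)"
  using assms by (intro continuous_map_mult) (auto simp: topspace_eq_carrier)

lemma continuous_map_difference_op:
  assumes G: "topological_group G T" and A: "topological_group A U"
    and f: "continuous_map T U f" and h: "h \<in> carrier G"
  shows "continuous_map T U (difference_op G A h f)"
  unfolding difference_op_def
proof (intro topological_group.continuous_map_mult[OF A])
  show "continuous_map T U (\<lambda>x. inv\<^bsub>A\<^esub> (f x))"
    using continuous_map_compose[OF f topological_group.continuous_inv[OF A]]
    by (simp add: o_def)
  show "continuous_map T U (\<lambda>x. f (x \<otimes>\<^bsub>G\<^esub> h))"
    using continuous_map_compose[OF topological_group.continuous_map_right_translation[OF G h] f]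
    by (simp add: o_def)
qed

lemma mult_difference_op:
  assumes "group A" and "f x \<in> carrier A" and "f (x \<otimes>\<^bsub>G\<^esub> h) \<in> carrier A"
  shows "f x \<otimes>\<^bsub>A\<^esub> difference_op G A h f x = f (x \<otimes>\<^bsub>G\<^esub> h)"
proof -
  interpret A: group A by fact
  show ?thesis
    using assms(2,3) by (simp add: difference_op_def flip: A.m_assoc)
qed

lemma difference_op_image_lepoll:
  assumes "group G" and "h \<in> carrier G"
  shows "difference_op G A h f ` carrier G \<lesssim> f ` carrier G \<times> f ` carrier G"
proof (rule subset_image_lepoll)
  interpret G: group G by fact
  show "difference_op G A h f ` carrier G
      \<subseteq> (\<lambda>(a, b). inv\<^bsub>A\<^esub> a \<otimes>\<^bsub>A\<^esub> b) ` (f ` carrier G \<times> f ` carrier G)"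
    using assms(2) by (force simp: difference_op_def)
qed

section \<open>Polynomial maps on compact groups\<close>

text \<open>
  Constancy on \<open>V\<close> alone gives nothing outside \<open>V\<close>; the finiteness of the images of the
  differences is what carries finiteness of the set of values from \<open>V\<close> to its translates.
\<close>

lemma finite_image_if_finite_differences:
  assumes G: "topological_group G T" and "compact_space T" and A: "group A"
    and f: "f \<in> carrier G \<rightarrow> carrier A"
    and V: "openin T V" "V \<noteq> {}" "\<And>v. v \<in> V \<Longrightarrow> f v = a"
    and fin: "\<And>h. h \<in> carrier G \<Longrightarrow> finite (difference_op G A h f ` carrier G)"
  shows "finite (f ` carrier G)"
proof -
  interpret G: topological_group G T by fact
  have top: "topspace T = carrier G"
    by (rule G.topspace_eq_carrier)
  have V_sub: "V \<subseteq> carrier G"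
    using openin_subset[OF V(1)] top by simp
  \<comment> \<open>The translate \<open>Vh\<close>, written as a preimage so that it is visibly open.\<close>
  define W where "W h = {x \<in> carrier G. x \<otimes>\<^bsub>G\<^esub> inv\<^bsub>G\<^esub> h \<in> V}" for h
  have W_open: "openin T (W h)" if "h \<in> carrier G" for h
    using openin_continuous_map_preimage[OF G.continuous_map_right_translation V(1), of "inv\<^bsub>G\<^esub> h"] that
    by (simp add: W_def top)
  obtain v where v: "v \<in> V"
    using V(2) by blast
  have "x \<in> \<Union> (W ` carrier G)" if x: "x \<in> carrier G" for x
  proof (rule UN_I)
    show "x \<in> W (inv\<^bsub>G\<^esub> v \<otimes>\<^bsub>G\<^esub> x)"
      using v V_sub x by (auto simp: W_def G.inv_mult_group simp flip: G.m_assoc)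
    show "inv\<^bsub>G\<^esub> v \<otimes>\<^bsub>G\<^esub> x \<in> carrier G"
      using v V_sub x by auto
  qed
  then have "topspace T \<subseteq> \<Union> (W ` carrier G)"
    unfolding top by blast
  moreover have "\<forall>S\<in>W ` carrier G. openin T S"
    using W_open by blast
  ultimately obtain \<F> where \<F>: "finite \<F>" "\<F> \<subseteq> W ` carrier G" "topspace T \<subseteq> \<Union>\<F>"
    using \<open>compact_space T\<close> unfolding compact_space_alt by meson
  then obtain H where H: "finite H" "H \<subseteq> carrier G" "carrier G \<subseteq> (\<Union>h\<in>H. W h)"
    unfolding top by (metis finite_subset_image)
  have "f ` W h \<subseteq> (\<lambda>b. a \<otimes>\<^bsub>A\<^esub> b) ` difference_op G A h f ` carrier G" if h: "h \<in> carrier G" for h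
  proof
    fix y assume "y \<in> f ` W h"
    then obtain x where x: "x \<in> carrier G" "x \<otimes>\<^bsub>G\<^esub> inv\<^bsub>G\<^esub> h \<in> V" "y = f x"
      by (auto simp: W_def)
    let ?v = "x \<otimes>\<^bsub>G\<^esub> inv\<^bsub>G\<^esub> h"
    have "?v \<in> carrier G" and vh: "?v \<otimes>\<^bsub>G\<^esub> h = x"
      using x(1) h by (simp_all add: G.m_assoc)
    moreover have "f ?v \<otimes>\<^bsub>A\<^esub> difference_op G A h f ?v = f x"
      using mult_difference_op[OF A, of f ?v G h] f x(1) vh \<open>?v \<in> carrier G\<close> by auto
    ultimately show "y \<in> (\<lambda>b. a \<otimes>\<^bsub>A\<^esub> b) ` difference_op G A h f ` carrier G"
      using V(3)[OF x(2)] x(3) by force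
  qed
  then have "finite (f ` W h)" if "h \<in> H" for h
    using that H(2) fin by (meson finite_imageI finite_subset subsetD)
  then have "finite (\<Union>h\<in>H. f ` W h)"
    using H(1) by blast
  moreover have "f ` carrier G \<subseteq> (\<Union>h\<in>H. f ` W h)"
    using H(3) by blast
  ultimately show ?thesis
    by (rule rev_finite_subset)
qed

text \<open>
  Here \<open>n\<close> bounds the degree strictly, so the induction starts from the trivial map and each
  difference lowers \<open>n\<close> by one.
\<close>

lemma finite_image_if_differences_vanish:
  assumes G: "topological_group G T" and compact: "compact_space T"
    and A: "topological_group A U" and Hausdorff: "Hausdorff_space U"
    and "continuous_map T U f"
    and "\<And>x hs. x \<in> carrier G \<Longrightarrow> length hs = n \<Longrightarrow> set hs \<subseteq> carrier G \<Longrightarrow>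
           fold (difference_op G A) hs f x = \<one>\<^bsub>A\<^esub>"
    and "\<not> (UNIV :: nat set set) \<lesssim> f ` carrier G"
  shows "finite (f ` carrier G)"
  using assms(5-7)
proof (induction n arbitrary: f)
  case 0
  then have "f ` carrier G \<subseteq> {\<one>\<^bsub>A\<^esub>}"
    by fastforce
  then show ?case
    using finite_subset by blast
next
  case (Suc n)
  interpret G: topological_group G T by fact
  interpret A: topological_group A U by fact
  note cont = Suc.prems(1) and small = Suc.prems(3)
  have top: "topspace T = carrier G"
    by (rule G.topspace_eq_carrier)
  have f: "f \<in> carrier G \<rightarrow> carrier A"
    using continuous_map_funspace[OF cont] by (simp add: top A.topspace_eq_carrier)
  have differences: "finite (difference_op G A h f ` carrier G)" if h: "h \<in> carrier G" for h
  proof (rule Suc.IH)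
    show "continuous_map T U (difference_op G A h f)"
      using continuous_map_difference_op[OF G A cont h] .
    show "fold (difference_op G A) hs (difference_op G A h f) x = \<one>\<^bsub>A\<^esub>"
      if "x \<in> carrier G" "length hs = n" "set hs \<subseteq> carrier G" for x hs
      using Suc.prems(2)[of x "h # hs"] that h by simp
    have "infinite (UNIV :: nat set set)"
      by (simp add: Finite_Set.finite_set infinite_UNIV_nat)
    then show "\<not> (UNIV :: nat set set) \<lesssim> difference_op G A h f ` carrier G"
      using small infinite_lepoll_square_imp_lepoll lepoll_trans
        difference_op_image_lepoll[OF G.group_axioms h] by metis
  qed
  let ?X = "subtopology U (f ` carrier G)"
  have X: "topspace ?X = f ` carrier G"
    using f by (auto simp: A.topspace_eq_carrier)
  have "compactin U (f ` carrier G)"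
    using image_compactin[OF _ cont] compact by (simp add: compact_space_def top)
  then have "compact_space ?X"
    by (rule compact_space_subtopology)
  moreover have "Hausdorff_space ?X"
    using Hausdorff by (rule Hausdorff_space_subtopology)
  moreover have "topspace ?X \<noteq> {}"
    using X G.one_closed by blast
  ultimately obtain a where a: "a \<in> f ` carrier G" "openin ?X {a}"
    using compact_Hausdorff_isolated_point[of ?X] small unfolding X by metis
  define V where "V = {x \<in> carrier G. f x = a}"
  have "continuous_map T ?X f"
    using cont by (simp add: continuous_map_in_subtopology top)
  then have "openin T V"
    using openin_continuous_map_preimage[OF _ a(2), of T f] by (simp add: V_def top)
  show ?case
  proof (rule finite_image_if_finite_differences[OF G compact A.group_axioms f])
    show "openin T V" by fact
    show "V \<noteq> {}"
      using a(1) unfolding V_def by blast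
    show "f v = a" if "v \<in> V" for v
      using that unfolding V_def by blast
  qed (rule differences)
qed

theorem proposition4p1:
  fixes G :: "('a, 'm) monoid_scheme" and T :: "'a topology"
    and A :: "('b, 'n) monoid_scheme" and U :: "'b topology"
    and f :: "'a \<Rightarrow> 'b"
  assumes "profinite_group G T"
    and "profinite_group A U"
    and "continuous_map T U f"
    and "polynomial_map G A f"
  shows "finite (f ` carrier G) \<or> (UNIV :: nat set set) \<lesssim> f ` carrier G"
proof -
  interpret G: profinite_group G T by fact
  interpret A: profinite_group A U by fact
  obtain n where "polynomial_map_deg_le G A n f"
    using assms(4) unfolding polynomial_map_def by blast
  then have "fold (difference_op G A) hs f x = \<one>\<^bsub>A\<^esub>"
    if "x \<in> carrier G" "length hs = n + 1" "set hs \<subseteq> carrier G" for x hs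
    using that unfolding polynomial_map_deg_le_def by blast
  then show ?thesis
    using finite_image_if_differences_vanish[OF G.topological_group_axioms G.compact
        A.topological_group_axioms A.Hausdorff assms(3)] by blast
qed

end
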